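(* Let $d\ge1$ and let $f$ be a uniformly continuous probability density on $\mathbb{R}^d$. Then the functions $x\mapsto\mathrm{C}_r(x,f)$ converge uniformly in $x\in\mathbb{R}^d$ as $r\to0^+$.
   Context: $\mathsf{B}(x,r)$ is the closed Euclidean ball of center $x$ and radius $r$, and $\omega$ is the volume of the unit ball of $\mathbb{R}^d$. For $r>0$ and a non-negative bounded measurable $\phi:\mathbb{R}^d\to\mathbb{R}$, $$\mathrm{H}_r\phi(x)=\sup\Big\{t\ge0 : \frac1{\omega r^d}\int_{\mathsf{B}(x,r)}\mathbf{1}_{\phi(z)\ge t}\,f(z)\,dz\ge t\Big\},$$ $\mathrm{H}_r^k$ is its $k$-th iterate, and $f_r(x)=\frac{1}{\omega r^d}\int_{\mathsf{B}(x,r)}f(z)\,dz$. The continuum $r$-coreness is $\mathrm{C}_r(x,f)=\lim_{k\to\infty}\mathrm{H}_r^kf_r(x)$ (this limit exists). (The limit of $\mathrm{C}_r(x,f)$ as $r\to0$ is called the continuum coreness and denoted $\mathrm{C}_0(x,f)$.) *)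

theory Defs
  imports "HOL-Analysis.Analysis"
begin

text \<open>
  The space \<open>\<real>\<^sup>d\<close> is an arbitrary type of class \<open>euclidean_space\<close>, so \<open>d = DIM('a)\<close>, and
  \<open>d \<ge> 1\<close> holds for every such type.
\<close>

definition prob_density :: "('a::euclidean_space \<Rightarrow> real) \<Rightarrow> bool" where
  "prob_density f \<longleftrightarrow> (\<forall>x. 0 \<le> f x) \<and> has_bochner_integral lborel f 1"

definition ball_average :: "real \<Rightarrow> ('a::euclidean_space \<Rightarrow> real) \<Rightarrow> 'a \<Rightarrow> real" where
  "ball_average r g x =
     1 / (measure lborel (cball (0::'a) 1) * r ^ DIM('a)) * (LINT z:cball x r|lborel. g z)"

text \<open>
  For \<open>r > 0\<close>, a density \<open>f\<close> and a non-negative bounded measurable \<open>\<phi>\<close>, the set below contains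
  \<open>0\<close> and is bounded above by \<open>ball_average r f x\<close>, so the supremum is a genuine one.
\<close>

definition H_op :: "('a::euclidean_space \<Rightarrow> real) \<Rightarrow> real \<Rightarrow> ('a \<Rightarrow> real) \<Rightarrow> 'a \<Rightarrow> real" where
  "H_op f r \<phi> x =
     Sup {t. 0 \<le> t \<and> t \<le> ball_average r (\<lambda>z. indicator {z. t \<le> \<phi> z} z * f z) x}"

text \<open>
  For \<open>r > 0\<close> and a density \<open>f\<close>, the iterates are non-negative and decrease pointwise in \<open>k\<close>,
  so the limit exists.
\<close>

definition continuum_coreness :: "('a::euclidean_space \<Rightarrow> real) \<Rightarrow> real \<Rightarrow> 'a \<Rightarrow> real" where
  "continuum_coreness f r x = lim (\<lambda>k. (H_op f r ^^ k) (ball_average r f) x)"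

end

theory Submission
  imports Defs
begin

text \<open>
  The coreness is governed by sets that support themselves at some scale. Call \<open>S\<close> self-supporting
  at scale \<open>r\<close> and level \<open>t\<close> if for every \<open>y \<in> S\<close> the integral of \<open>f\<close> over \<open>cball y r \<inter> S\<close> is at
  least \<open>t\<close> times the volume of \<open>cball y r\<close>. By induction on the iterates, the coreness at scale \<open>r\<close>
  is at least \<open>t\<close> on such a set; conversely the superlevel set of the coreness at level \<open>t\<close> is the
  decreasing intersection of the superlevel sets of the iterates, and passing to the limit in the
  inequalities that define \<open>H_op\<close> shows that it is self-supporting. So
  \<open>continuum_coreness f r x\<close> is the largest level of a set containing \<open>x\<close> that is self-supporting
  at scale \<open>r\<close>.

  The heart of the proof (\<open>self_supporting_thickening\<close>) transports self-supporting sets between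
  scales. Fix \<open>\<rho>\<close> so small that \<open>f\<close> hardly varies over distances below \<open>\<rho>\<close>, and let \<open>r\<close> and \<open>r'\<close> both
  be much smaller than \<open>\<rho>\<close>. If \<open>S\<close> is self-supporting at scale \<open>r\<close> and level \<open>t\<close>, then its
  \<open>\<rho>\<close>-neighbourhood \<open>S'\<close> is self-supporting at scale \<open>r'\<close> and a level slightly below \<open>t\<close>:

  \<^item> \<open>f\<close> is at least about \<open>t\<close> on \<open>S\<close>, hence on \<open>S'\<close>, and this is enough at those points of \<open>S'\<close>
    whose \<open>r'\<close>-ball lies in \<open>S'\<close>.

  \<^item> Let \<open>z \<in> S'\<close> be close to the boundary and \<open>y \<in> S\<close> almost nearest to \<open>z\<close>. The ball around \<open>z\<close>
    with radius \<open>d = infdist z S\<close> misses \<open>S\<close>, and since \<open>d\<close> is much larger than \<open>r\<close> it covers almost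
    half of \<open>cball y r\<close>. So only about half of that ball can support \<open>y\<close>, which forces \<open>f\<close> to be
    about \<open>2 * t\<close> at \<open>y\<close> and near it. Likewise \<open>ball y \<rho>\<close>, a part of \<open>S'\<close>, covers almost half of
    \<open>cball z r'\<close>, and half of the ball with density \<open>2 * t\<close> supports the level \<open>t\<close>.

  This goes from any small scale to any other, up or down. Applied to the superlevel sets of the coreness, in
  both directions, it shows that any two corenesses at scales below a threshold depending only on
  \<open>\<epsilon>\<close> (and \<open>f\<close>) differ by at most \<open>\<epsilon>\<close> everywhere, which is the uniform Cauchy property.
\<close>

section \<open>Half balls\<close>

lemma compact_half_cball: "compact {v \<in> cball 0 1. 0 \<le> v \<bullet> (u::'a::euclidean_space)}"
proof -
  have "closed {v. 0 \<le> v \<bullet> u}"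
    by (intro closed_Collect_le continuous_intros)
  then have "compact (cball 0 1 \<inter> {v. 0 \<le> v \<bullet> u})"
    by (rule compact_Int_closed[OF compact_cball])
  also have "cball 0 1 \<inter> {v. 0 \<le> v \<bullet> u} = {v \<in> cball 0 1. 0 \<le> v \<bullet> u}" by blast
  finally show ?thesis .
qed

text \<open>
  A closed half ball and its reflection through the origin cover the ball. For \<open>u = 0\<close> the set
  is the whole ball, which is why an inequality is stated.
\<close>

lemma measure_half_cball:
  fixes u :: "'a::euclidean_space"
  shows "measure lebesgue (cball 0 1 :: 'a set) / 2 \<le> measure lebesgue {v \<in> cball 0 1. 0 \<le> v \<bullet> u}"
proof -
  define H where "H = {v \<in> cball 0 1. 0 \<le> v \<bullet> u}"
  have "compact H" unfolding H_def by (rule compact_half_cball)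
  then have H: "H \<in> lmeasurable" by (rule lmeasurable_compact)
  define T where "T = (\<lambda>v::'a. (-1) *\<^sub>R v + 0)"
  have T: "measure lebesgue (T ` H) = measure lebesgue H"
    unfolding T_def by (subst measure_lebesgue_affine) simp
  have "compact (T ` H)"
    using \<open>compact H\<close> unfolding T_def by (intro compact_continuous_image continuous_intros)
  then have TH: "T ` H \<in> lmeasurable" by (rule lmeasurable_compact)
  have "cball 0 1 \<subseteq> H \<union> T ` H"
  proof
    fix v :: 'a assume v: "v \<in> cball 0 1"
    show "v \<in> H \<union> T ` H"
    proof (cases "0 \<le> v \<bullet> u")
      case False
      with v have "-v \<in> H" by (simp add: H_def)
      then have "T (-v) \<in> T ` H" by (rule imageI)
      then show ?thesis by (simp add: T_def)
    qed (use v in \<open>simp add: H_def\<close>)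
  qed
  then have "measure lebesgue (cball 0 1 :: 'a set) \<le> measure lebesgue (H \<union> T ` H)"
    using H TH by (intro measure_mono_fmeasurable fmeasurable.Un) auto
  also have "\<dots> \<le> measure lebesgue H + measure lebesgue (T ` H)"
    using H TH by (intro measure_Un_le) (auto dest: fmeasurableD)
  finally show ?thesis using T by (simp add: H_def)
qed

lemma measure_cball_scale:
  assumes "0 \<le> r"
  shows "measure lborel (cball (x::'a::euclidean_space) r) = measure lborel (cball (0::'a) 1) * r ^ DIM('a)"
  using assms by (simp add: content_cball)

text \<open>
  A ball whose boundary passes near the centre \<open>y\<close> of a much smaller ball contains almost half of it.
  A half ball \<open>H\<close> in the direction \<open>u\<close> of \<open>w\<close>, shrunk to \<open>(1 - h) H + h u\<close>, stays in the unit ball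
  by convexity and is separated from the bounding hyperplane by \<open>h\<close>; the last hypothesis says that
  this gap absorbs the curvature of \<open>ball w s\<close> and the distance by which \<open>y\<close> may lie outside it.
  Shrinking, rather than cutting off a slab, makes the lost volume the same in all directions.
\<close>

lemma measure_cball_Int_ball_ge:
  fixes y w :: "'a::euclidean_space"
  assumes r: "0 < r" and h: "0 \<le> h" "h < 1" and s: "0 < s"
    and *: "r\<^sup>2 + (dist y w)\<^sup>2 < s\<^sup>2 + 2 * r * dist y w * h"
  shows "(1 - h) ^ DIM('a) / 2 * measure lborel (cball y r) \<le> measure lborel (cball y r \<inter> ball w s)"
proof -
  \<comment> \<open>If \<open>w = y\<close> then \<open>u = 0\<close> and \<open>H\<close> below is the whole ball, which is harmless.\<close>
  define u where "u = sgn (w - y)"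
  define a where "a = dist y w"
  have a: "w - y = a *\<^sub>R u"
    by (cases "w = y") (simp_all add: u_def a_def sgn_div_norm dist_norm norm_minus_commute)
  have a0: "0 \<le> a" by (simp add: a_def)
  have u1: "norm u \<le> 1" by (simp add: u_def norm_sgn)
  define H where "H = {v \<in> cball 0 1. 0 \<le> v \<bullet> u}"
  have "compact H" unfolding H_def by (rule compact_half_cball)
  define T where "T = (\<lambda>v. (r * (1 - h)) *\<^sub>R v + (y + (r * h) *\<^sub>R u))"
  have "compact (T ` H)"
    using \<open>compact H\<close> unfolding T_def by (intro compact_continuous_image continuous_intros)
  have sub: "T ` H \<subseteq> cball y r \<inter> ball w s"
  proof
    fix x assume "x \<in> T ` H"
    then obtain v where v: "norm v \<le> 1" "0 \<le> v \<bullet> u" and x: "x = T v"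
      by (auto simp: H_def)
    define q where "q = (1 - h) *\<^sub>R v + h *\<^sub>R u"
    have xq: "x - y = r *\<^sub>R q" by (simp add: x T_def q_def algebra_simps)
    have "norm q \<le> (1 - h) * norm v + h * norm u"
      unfolding q_def using h by (intro order_trans[OF norm_triangle_ineq]) simp
    also have "\<dots> \<le> (1 - h) * 1 + h * 1"
      using h v u1 by (intro add_mono mult_left_mono) auto
    finally have q1: "norm q \<le> 1" by simp
    have qu: "a * h \<le> a * (q \<bullet> u)"
    proof (cases "w = y")
      case True then show ?thesis by (simp add: a_def)
    next
      case False
      then have "u \<bullet> u = 1" by (simp add: u_def norm_sgn dot_square_norm)
      then have "q \<bullet> u = (1 - h) * (v \<bullet> u) + h" by (simp add: q_def inner_add_left)
      then have "h \<le> q \<bullet> u" using h v by simp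
      then show ?thesis using a0 by (rule mult_left_mono)
    qed
    have "norm (x - y) \<le> r" using q1 r by (simp add: xq)
    then have 1: "x \<in> cball y r" by (simp add: dist_norm norm_minus_commute)
    have "(dist w x)\<^sup>2 = (norm ((x - y) - (w - y)))\<^sup>2" by (simp add: dist_norm norm_minus_commute)
    also have "\<dots> = (r * norm q)\<^sup>2 - 2 * r * (a * (q \<bullet> u)) + (norm (w - y))\<^sup>2"
      unfolding power2_norm_eq_inner power_mult_distrib
      by (simp add: xq a inner_diff inner_commute algebra_simps power2_eq_square)
    also have "\<dots> \<le> r\<^sup>2 - 2 * r * (a * h) + a\<^sup>2"
    proof (intro add_mono diff_mono)
      show "(r * norm q)\<^sup>2 \<le> r\<^sup>2"
        using q1 r by (intro power_mono) (auto simp: mult_left_le)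
      show "2 * r * (a * h) \<le> 2 * r * (a * (q \<bullet> u))"
        using r by (intro mult_left_mono[OF qu]) simp
    qed (simp add: a_def dist_norm norm_minus_commute)
    also have "\<dots> < s\<^sup>2" using * by (simp add: a_def algebra_simps)
    finally have "dist w x < s" using s by (simp add: power2_less_imp_less)
    with 1 show "x \<in> cball y r \<inter> ball w s" by simp
  qed
  have "(1 - h) ^ DIM('a) / 2 * measure lborel (cball y r)
      = (r * (1 - h)) ^ DIM('a) * (measure lborel (cball (0::'a) 1) / 2)"
    using r by (subst measure_cball_scale) (auto simp: power_mult_distrib)
  also have "\<dots> \<le> (r * (1 - h)) ^ DIM('a) * measure lebesgue H"
    using measure_half_cball[of u] r h
    by (intro mult_left_mono) (auto simp: H_def)
  also have "\<dots> = measure lebesgue (T ` H)"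
    unfolding T_def using r h by (subst measure_lebesgue_affine) simp
  also have "\<dots> \<le> measure lebesgue (cball y r \<inter> ball w s)"
    using sub \<open>compact (T ` H)\<close>
    by (intro measure_mono_fmeasurable fmeasurable.Int)
      (auto intro: lmeasurable_compact fmeasurableD)
  also have "\<dots> = measure lborel (cball y r \<inter> ball w s)"
    by simp
  finally show ?thesis .
qed

section \<open>The coreness and its superlevel sets\<close>

context
  fixes f :: "'a::euclidean_space \<Rightarrow> real"
  assumes f_nonneg: "\<And>x. 0 \<le> f x" and f_int: "integrable lborel f"
begin

lemma set_integrable_f: "A \<in> sets borel \<Longrightarrow> set_integrable lborel A f"
  using set_integrable_subset[of lborel UNIV f A] f_int by (simp add: set_integrable_def)

lemma set_integral_f_mono:
  assumes "A \<subseteq> B" "A \<in> sets borel" "B \<in> sets borel"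
  shows "(LINT z:A|lborel. f z) \<le> (LINT z:B|lborel. f z)"
  using set_integrable_f[OF assms(2)] set_integrable_f[OF assms(3)] assms(1) f_nonneg
  unfolding set_lebesgue_integral_def set_integrable_def
  by (intro integral_mono) (auto simp: indicator_def)

lemma set_integral_f_bounds:
  assumes A: "A \<in> sets borel" "bounded A"
  shows "(\<And>z. z \<in> A \<Longrightarrow> c \<le> f z) \<Longrightarrow> c * measure lborel A \<le> (LINT z:A|lborel. f z)"
    and "(\<And>z. z \<in> A \<Longrightarrow> f z \<le> c) \<Longrightarrow> (LINT z:A|lborel. f z) \<le> c * measure lborel A"
proof -
  have fin: "emeasure lborel A < \<infinity>"
    using A(2) by (rule emeasure_bounded_finite)
  have c: "(LINT z:A|lborel. c) = c * measure lborel A"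
    using A fin by (simp add: set_integral_const measure_def)
  have ci: "set_integrable lborel A (\<lambda>_. c)"
    using A fin by (simp add: set_integrable_def)
  show "(\<And>z. z \<in> A \<Longrightarrow> c \<le> f z) \<Longrightarrow> c * measure lborel A \<le> (LINT z:A|lborel. f z)"
    using set_integral_mono[OF ci set_integrable_f[OF A(1)]] c by simp
  show "(\<And>z. z \<in> A \<Longrightarrow> f z \<le> c) \<Longrightarrow> (LINT z:A|lborel. f z) \<le> c * measure lborel A"
    using set_integral_mono[OF set_integrable_f[OF A(1)] ci] c by simp
qed

lemma le_ball_average_indicator_iff:
  assumes "0 < r"
  shows "t \<le> ball_average r (\<lambda>z. indicator S z * f z) x \<longleftrightarrow>
    t * measure lborel (cball x r) \<le> (LINT z:cball x r \<inter> S|lborel. f z)"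
proof -
  have "(LINT z:cball x r|lborel. indicator S z * f z) = (LINT z:cball x r \<inter> S|lborel. f z)"
    unfolding set_lebesgue_integral_def
    by (rule Bochner_Integration.integral_cong) (auto simp: indicator_def)
  moreover have "0 < measure lborel (cball (0::'a) 1) * r ^ DIM('a)"
    using assms by simp
  ultimately show ?thesis
    using assms unfolding ball_average_def measure_cball_scale[OF less_imp_le[OF assms]]
    by (simp add: field_simps)
qed

lemma le_ball_average_iff:
  assumes "0 < r"
  shows "t \<le> ball_average r f x \<longleftrightarrow>
    t * measure lborel (cball x r) \<le> (LINT z:cball x r|lborel. f z)"
  using le_ball_average_indicator_iff[OF assms, of t UNIV x] by simp

text \<open>
  The supremum that defines \<open>H_op\<close> is attained: as \<open>s\<close> increases to \<open>t\<close>, the sets \<open>{z. s \<le> \<phi> z}\<close>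
  decrease to \<open>{z. t \<le> \<phi> z}\<close>, and the integral is continuous along decreasing sets. This turns all
  later statements about \<open>H_op\<close> into statements about integrals over superlevel sets.
\<close>

lemma le_H_op_iff:
  assumes r: "0 < r" and \<phi> [measurable]: "\<phi> \<in> borel_measurable borel" and t: "0 \<le> t"
  shows "t \<le> H_op f r \<phi> x \<longleftrightarrow>
    t * measure lborel (cball x r) \<le> (LINT z:cball x r \<inter> {z. t \<le> \<phi> z}|lborel. f z)"
proof -
  define V where "V = measure lborel (cball x r)"
  have V: "0 < V" using r by (simp add: V_def)
  define A where "A s = cball x r \<inter> {z. s \<le> \<phi> z}" for s
  have A [measurable]: "A s \<in> sets borel" for s by (simp add: A_def)
  define E where "E = {s. 0 \<le> s \<and> s * V \<le> (LINT z:A s|lborel. f z)}"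
  have H: "H_op f r \<phi> x = Sup E"
    by (simp add: H_op_def E_def le_ball_average_indicator_iff[OF r] V_def A_def)
  have bdd: "bdd_above E"
  proof (rule bdd_aboveI)
    fix s assume "s \<in> E"
    then have "s * V \<le> (LINT z:A s|lborel. f z)" by (simp add: E_def)
    also have "\<dots> \<le> (LINT z:cball x r|lborel. f z)"
      by (rule set_integral_f_mono) (auto simp: A_def)
    finally show "s \<le> (LINT z:cball x r|lborel. f z) / V" using V by (simp add: field_simps)
  qed
  have "0 \<in> E"
    using f_nonneg by (auto simp: E_def set_lebesgue_integral_def intro!: integral_nonneg)
  have "t \<in> E" if le: "t \<le> Sup E"
  proof (cases "t = 0")
    case True
    then show ?thesis using \<open>0 \<in> E\<close> by simp
  next
    case False
    \<comment> \<open>Approach \<open>t\<close> strictly from below by levels that belong to the set.\<close>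
    define s where "s n = t - t / real (Suc n)" for n
    have s_lim: "s \<longlonglongrightarrow> t"
      using tendsto_diff[OF tendsto_const tendsto_mult_right_zero[OF LIMSEQ_inverse_real_of_nat, of t], of t]
      by (simp add: s_def[abs_def] divide_inverse)
    have s_less: "s n < t" for n using False t by (simp add: s_def)
    have s_inc: "incseq s"
      unfolding s_def using t by (intro incseq_SucI diff_mono divide_left_mono) auto
    have "s n * V \<le> (LINT z:A (s n)|lborel. f z)" for n
    proof -
      obtain e where e: "e \<in> E" "s n < e"
        using less_cSupD[of E "s n"] \<open>0 \<in> E\<close> s_less[of n] le by fastforce
      have "s n * V \<le> e * V" using e V by simp
      also have "\<dots> \<le> (LINT z:A e|lborel. f z)" using e by (simp add: E_def)
      also have "\<dots> \<le> (LINT z:A (s n)|lborel. f z)"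
        using e by (intro set_integral_f_mono) (auto simp: A_def)
      finally show ?thesis .
    qed
    moreover have "(\<lambda>n. LINT z:A (s n)|lborel. f z) \<longlonglongrightarrow> (LINT z:(\<Inter>n. A (s n))|lborel. f z)"
      using s_inc by (intro set_integral_cont_down set_integrable_f)
        (auto simp: A_def decseq_def incseq_def intro: order_trans)
    moreover have "(\<Inter>n. A (s n)) = A t"
      using s_less s_lim by (auto simp: A_def intro: LIMSEQ_le_const2 less_imp_le order_trans)
    moreover have "(\<lambda>n. s n * V) \<longlonglongrightarrow> t * V" using s_lim by (intro tendsto_intros)
    ultimately have "t * V \<le> (LINT z:A t|lborel. f z)"
      by (intro LIMSEQ_le) auto
    then show ?thesis using t by (simp add: E_def)
  qed
  then have "t \<le> Sup E \<longleftrightarrow> t \<in> E" using cSup_upper[OF _ bdd] by blast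
  then show ?thesis using t by (simp add: H E_def V_def A_def)
qed

lemma H_op_nonneg:
  assumes "0 < r" "\<phi> \<in> borel_measurable borel"
  shows "0 \<le> H_op f r \<phi> x"
  using f_nonneg
  by (subst le_H_op_iff[OF assms])
    (auto simp: set_lebesgue_integral_def intro!: integral_nonneg)

lemma H_op_mono:
  assumes r: "0 < r" and [measurable]: "\<phi> \<in> borel_measurable borel" "\<psi> \<in> borel_measurable borel"
    and le: "\<And>z. \<phi> z \<le> \<psi> z"
  shows "H_op f r \<phi> x \<le> H_op f r \<psi> x"
proof -
  let ?t = "H_op f r \<phi> x"
  have t: "0 \<le> ?t" by (simp add: H_op_nonneg r)
  have "?t * measure lborel (cball x r) \<le> (LINT z:cball x r \<inter> {z. ?t \<le> \<phi> z}|lborel. f z)"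
    using le_H_op_iff[OF r _ t, of \<phi> x] by simp
  also have "\<dots> \<le> (LINT z:cball x r \<inter> {z. ?t \<le> \<psi> z}|lborel. f z)"
    using le by (intro set_integral_f_mono) (auto intro: order_trans)
  finally show ?thesis using le_H_op_iff[OF r _ t, of \<psi> x] by simp
qed

lemma H_op_le_ball_average:
  assumes r: "0 < r" and [measurable]: "\<phi> \<in> borel_measurable borel"
  shows "H_op f r \<phi> x \<le> ball_average r f x"
proof -
  let ?t = "H_op f r \<phi> x"
  have t: "0 \<le> ?t" by (simp add: H_op_nonneg r)
  have "?t * measure lborel (cball x r) \<le> (LINT z:cball x r \<inter> {z. ?t \<le> \<phi> z}|lborel. f z)"
    using le_H_op_iff[OF r _ t, of \<phi> x] by simp
  also have "\<dots> \<le> (LINT z:cball x r|lborel. f z)"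
    by (intro set_integral_f_mono) auto
  finally show ?thesis by (simp add: le_ball_average_iff[OF r])
qed

lemma set_integral_cball_measurable:
  assumes [measurable]: "S \<in> sets borel"
  shows "(\<lambda>x. LINT z:cball x r \<inter> S|lborel. f z) \<in> borel_measurable borel"
proof -
  have [measurable]: "f \<in> borel_measurable borel"
    using f_int by (simp add: borel_measurable_integrable)
  have "(\<lambda>x. LINT z|lborel. (if dist x z \<le> r \<and> z \<in> S then f z else 0)) \<in> borel_measurable borel"
    by measurable
  also have "(\<lambda>x. LINT z|lborel. (if dist x z \<le> r \<and> z \<in> S then f z else 0))
      = (\<lambda>x. LINT z:cball x r \<inter> S|lborel. f z)"
    unfolding set_lebesgue_integral_def
    by (intro ext Bochner_Integration.integral_cong) (auto simp: indicator_def)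
  finally show ?thesis .
qed

text \<open>
  Measurability has to be carried along the iteration, because an integral over a non-measurable
  superlevel set would have the default value \<open>0\<close>.
\<close>

lemma H_op_measurable:
  assumes r: "0 < r" and \<phi> [measurable]: "\<phi> \<in> borel_measurable borel"
  shows "H_op f r \<phi> \<in> borel_measurable borel"
  unfolding borel_measurable_iff_ge
proof
  fix t
  show "{x \<in> space borel. t \<le> H_op f r \<phi> x} \<in> sets borel"
  proof (cases "0 \<le> t")
    case True
    have [measurable]: "(\<lambda>x. LINT z:cball x r \<inter> {z. t \<le> \<phi> z}|lborel. f z) \<in> borel_measurable borel"
      by (rule set_integral_cball_measurable) simp
    show ?thesis
      by (simp add: le_H_op_iff[OF r \<phi> True] measure_cball_scale[OF less_imp_le[OF r]])
  next
    case False
    then have "t \<le> H_op f r \<phi> x" for x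
      using H_op_nonneg[OF r \<phi>, of x] by linarith
    then show ?thesis by simp
  qed
qed

abbreviation H_iter :: "real \<Rightarrow> nat \<Rightarrow> 'a \<Rightarrow> real" where
  "H_iter r k \<equiv> (H_op f r ^^ k) (ball_average r f)"

lemma H_iter_measurable [measurable]:
  assumes "0 < r"
  shows "H_iter r k \<in> borel_measurable borel"
proof (induction k)
  case 0
  have "ball_average r f = (\<lambda>x. 1 / (measure lborel (cball (0::'a) 1) * r ^ DIM('a)) *
      (LINT z:cball x r \<inter> UNIV|lborel. f z))"
    by (auto simp: ball_average_def)
  also have "\<dots> \<in> borel_measurable borel"
    by (intro borel_measurable_times borel_measurable_const set_integral_cball_measurable) simp
  finally show ?case by simp
next
  case (Suc k)
  then show ?case using H_op_measurable[OF assms] by simp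
qed

lemma H_iter_nonneg:
  assumes "0 < r"
  shows "0 \<le> H_iter r k x"
proof (cases k)
  case 0
  have "0 \<le> ball_average r f x"
    using f_nonneg
    by (auto simp: le_ball_average_iff[OF assms] set_lebesgue_integral_def intro!: integral_nonneg)
  with 0 show ?thesis by simp
qed (use H_op_nonneg H_iter_measurable assms in simp)

lemma H_iter_decseq:
  assumes "0 < r"
  shows "decseq (\<lambda>k. H_iter r k x)"
proof (rule decseq_SucI)
  fix k
  show "H_iter r (Suc k) x \<le> H_iter r k x"
  proof (induction k arbitrary: x)
    case 0
    show ?case using H_op_le_ball_average[OF assms H_iter_measurable[OF assms, of 0]] by simp
  next
    case (Suc k)
    have "H_op f r (H_iter r (Suc k)) x \<le> H_op f r (H_iter r k) x"
      by (intro H_op_mono assms H_iter_measurable Suc)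
    then show ?case by simp
  qed
qed

lemma le_coreness_iff:
  assumes "0 < r"
  shows "t \<le> continuum_coreness f r x \<longleftrightarrow> (\<forall>k. t \<le> H_iter r k x)"
proof -
  obtain L where L: "(\<lambda>k. H_iter r k x) \<longlonglongrightarrow> L" "\<forall>k. L \<le> H_iter r k x"
    using decseq_convergent[OF H_iter_decseq[OF assms], of 0 x] H_iter_nonneg[OF assms] by blast
  have "continuum_coreness f r x = L"
    unfolding continuum_coreness_def using L(1) by (rule limI)
  with L show ?thesis by (auto intro: LIMSEQ_le_const order_trans)
qed

lemma coreness_nonneg: "0 < r \<Longrightarrow> 0 \<le> continuum_coreness f r x"
  by (simp add: le_coreness_iff H_iter_nonneg)

definition self_supporting :: "real \<Rightarrow> real \<Rightarrow> 'a set \<Rightarrow> bool" where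
  "self_supporting r t S \<longleftrightarrow> S \<in> sets borel \<and>
     (\<forall>y\<in>S. t * measure lborel (cball y r) \<le> (LINT z:cball y r \<inter> S|lborel. f z))"

text \<open>
  By induction, every iterate is at least \<open>t\<close> on \<open>S\<close>: its superlevel set at level \<open>t\<close> contains \<open>S\<close>,
  so it supports the points of \<open>S\<close> at least as well as \<open>S\<close> does.
\<close>

lemma le_coreness_if_self_supporting:
  assumes r: "0 < r" and t: "0 \<le> t" and S: "self_supporting r t S" and x: "x \<in> S"
  shows "t \<le> continuum_coreness f r x"
proof -
  have [measurable]: "S \<in> sets borel" using S by (simp add: self_supporting_def)
  have sup: "t * measure lborel (cball y r) \<le> (LINT z:cball y r \<inter> S|lborel. f z)" if "y \<in> S" for y
    using S that by (simp add: self_supporting_def)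
  have "\<forall>y\<in>S. t \<le> H_iter r k y" for k
  proof (induction k)
    case 0
    show ?case
    proof
      fix y assume "y \<in> S"
      note sup[OF this]
      also have "(LINT z:cball y r \<inter> S|lborel. f z) \<le> (LINT z:cball y r|lborel. f z)"
        by (intro set_integral_f_mono) auto
      finally show "t \<le> H_iter r 0 y" by (simp add: le_ball_average_iff[OF r])
    qed
  next
    case (Suc k)
    have [measurable]: "H_iter r k \<in> borel_measurable borel" by (rule H_iter_measurable[OF r])
    show ?case
    proof
      fix y assume "y \<in> S"
      note sup[OF this]
      also have "(LINT z:cball y r \<inter> S|lborel. f z)
          \<le> (LINT z:cball y r \<inter> {z. t \<le> H_iter r k z}|lborel. f z)"
        using Suc by (intro set_integral_f_mono) auto
      finally show "t \<le> H_iter r (Suc k) y"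
        by (simp add: le_H_op_iff[OF r _ t])
    qed
  qed
  with x show ?thesis by (simp add: le_coreness_iff[OF r])
qed

text \<open>
  A point of the superlevel set of the coreness lies in the superlevel set of every iterate, so it is
  supported by the superlevel set of every iterate. These sets decrease to the one of the coreness.
\<close>

lemma self_supporting_coreness_superlevel:
  assumes r: "0 < r" and t: "0 \<le> t"
  shows "self_supporting r t {x. t \<le> continuum_coreness f r x}"
proof -
  define S where "S k = {x. t \<le> H_iter r k x}" for k
  have [measurable]: "H_iter r k \<in> borel_measurable borel" for k by (rule H_iter_measurable[OF r])
  have S [measurable]: "S k \<in> sets borel" for k unfolding S_def by simp
  have eq: "{x. t \<le> continuum_coreness f r x} = (\<Inter>k. S k)"
    by (auto simp: S_def le_coreness_iff[OF r])
  have "t * measure lborel (cball y r) \<le> (LINT z:cball y r \<inter> (\<Inter>k. S k)|lborel. f z)"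
    if y: "y \<in> (\<Inter>k. S k)" for y
  proof -
    have "(\<lambda>k. LINT z:cball y r \<inter> S k|lborel. f z)
        \<longlonglongrightarrow> (LINT z:(\<Inter>k. cball y r \<inter> S k)|lborel. f z)"
    proof (intro set_integral_cont_down set_integrable_f)
      have "decseq S"
        using H_iter_decseq[OF r] by (fastforce simp: S_def decseq_def intro: order_trans)
      then show "decseq (\<lambda>k. cball y r \<inter> S k)" by (auto simp: decseq_def)
    qed auto
    moreover have "t * measure lborel (cball y r) \<le> (LINT z:cball y r \<inter> S k|lborel. f z)" for k
    proof -
      have "t \<le> H_iter r (Suc k) y" using y unfolding S_def by blast
      then show ?thesis by (simp add: le_H_op_iff[OF r _ t] S_def)
    qed
    ultimately show ?thesis by (auto intro: LIMSEQ_le_const)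
  qed
  then show ?thesis unfolding self_supporting_def eq by auto
qed

section \<open>Changing the scale of a self-supporting set\<close>

text \<open>
  The parameter \<open>h\<close> controls both how small the scales are compared with \<open>\<rho>\<close> and how far the
  intersections of balls are from being half balls: these are at least the fraction
  \<open>(1 - h) ^ DIM('a) / 2\<close> of the smaller ball. The loss \<open>\<epsilon>\<close> accounts for the oscillation \<open>\<eta>\<close> of \<open>f\<close>
  and, through the bound \<open>M\<close>, for the missing part of the half balls. The same set serves all \<open>r'\<close>
  in the admissible range, whether \<open>r'\<close> is smaller or larger than \<open>r\<close>.
\<close>

lemma self_supporting_thickening:
  assumes h: "0 < h" "h \<le> 1/2" and \<rho>: "0 < \<rho>"
    and r: "0 < r" "r \<le> h * \<rho> / 2" and r': "0 < r'" "r' \<le> h * \<rho> / 2"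
    and osc: "\<And>x y. dist x y < \<rho> \<Longrightarrow> \<bar>f x - f y\<bar> \<le> \<eta>"
    and M: "\<And>x. f x \<le> M"
    and S: "self_supporting r t S" "S \<noteq> {}"
    and \<epsilon>: "4 * \<eta> + 2 * (M + \<eta>) * (1 - (1 - h) ^ DIM('a)) \<le> \<epsilon>" and t: "\<epsilon> \<le> t"
  shows "self_supporting r' (t - \<epsilon>) {z. infdist z S < \<rho>}"
proof -
  define q where "q = (1 - h) ^ DIM('a)"
  define S' where "S' = {z. infdist z S < \<rho>}"
  have q: "0 < q" "q \<le> 1" using h by (auto simp: q_def power_le_one)
  have \<eta>: "0 \<le> \<eta>" using osc[of 0 0] \<rho> by simp
  have M0: "0 \<le> M" using M[of 0] f_nonneg[of 0] by linarith
  have \<epsilon>': "4 * \<eta> + 2 * ((M + \<eta>) * (1 - q)) \<le> \<epsilon>" using \<epsilon> by (simp only: q_def mult.assoc)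
  have "0 \<le> (M + \<eta>) * (1 - q)" using M0 \<eta> q by simp
  then have \<epsilon>4: "4 * \<eta> \<le> \<epsilon>" using \<epsilon>' by linarith
  have "h * \<rho> \<le> 1/2 * \<rho>" using h \<rho> by (intro mult_right_mono) auto
  then have r4: "r \<le> \<rho> / 4" "r' \<le> \<rho> / 4" using r r' by auto
  have [measurable]: "S \<in> sets borel" using S by (simp add: self_supporting_def)
  have sup: "t * measure lborel (cball y r) \<le> (LINT z:cball y r \<inter> S|lborel. f z)" if "y \<in> S" for y
    using S that by (simp add: self_supporting_def)
  have "open S'" unfolding S'_def by (intro open_Collect_less continuous_intros)
  then have [measurable]: "S' \<in> sets borel" by auto
  have near: "\<exists>y\<in>S. dist z y < e" if "infdist z S < e" for z e
    using that S(2) cInf_lessD[of "dist z ` S" e] by (auto simp: infdist_notempty)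
  have upper: "t * measure lborel (cball y r) \<le> (f y + \<eta>) * measure lborel (cball y r \<inter> S)"
    if y: "y \<in> S" for y
  proof -
    note sup[OF y]
    also have "(LINT z:cball y r \<inter> S|lborel. f z) \<le> (f y + \<eta>) * measure lborel (cball y r \<inter> S)"
    proof (rule set_integral_f_bounds)
      fix z assume "z \<in> cball y r \<inter> S"
      then have "dist z y < \<rho>" using r4 \<rho> by (simp add: dist_commute)
      from osc[OF this] show "f z \<le> f y + \<eta>" by linarith
    qed (auto intro: bounded_Int)
    finally show ?thesis .
  qed
  have fS: "t - \<eta> \<le> f y" if y: "y \<in> S" for y
  proof -
    have V: "0 < measure lborel (cball y r)" using r by simp
    have "t * measure lborel (cball y r) \<le> (f y + \<eta>) * measure lborel (cball y r \<inter> S)"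
      by (rule upper[OF y])
    also have "\<dots> \<le> (f y + \<eta>) * measure lborel (cball y r)"
      using f_nonneg[of y] \<eta>
      by (intro mult_left_mono measure_mono_fmeasurable) (auto intro!: fmeasurable_compact)
    finally show ?thesis using V by simp
  qed
  have fS': "t - 2 * \<eta> \<le> f p" if p: "p \<in> S'" for p
  proof -
    obtain y where "y \<in> S" "dist p y < \<rho>" using near p unfolding S'_def by blast
    with fS[of y] osc[of p y] show ?thesis by linarith
  qed
  have "(t - \<epsilon>) * measure lborel (cball z r') \<le> (LINT p:cball z r' \<inter> S'|lborel. f p)"
    if z: "z \<in> S'" for z
  proof (cases "infdist z S < \<rho> - r'")
    case True
    have "cball z r' \<subseteq> S'"
    proof
      fix p assume "p \<in> cball z r'"
      then show "p \<in> S'" using True infdist_triangle[of p S z] by (simp add: S'_def dist_commute)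
    qed
    then have eq: "cball z r' \<inter> S' = cball z r'" by blast
    have "(t - \<epsilon>) * measure lborel (cball z r') \<le> (t - 2 * \<eta>) * measure lborel (cball z r')"
      using \<epsilon>4 \<eta> by (intro mult_right_mono) auto
    also have "\<dots> \<le> (LINT p:cball z r' \<inter> S'|lborel. f p)"
      using fS' \<open>cball z r' \<subseteq> S'\<close> unfolding eq by (intro set_integral_f_bounds) auto
    finally show ?thesis .
  next
    case False
    \<comment> \<open>\<open>z\<close> is close to the boundary of \<open>S'\<close>.\<close>
    define d where "d = infdist z S"
    have d: "\<rho> / 2 \<le> d" "d < \<rho>" using False z r4 by (auto simp: d_def S'_def)
    \<comment> \<open>The infimum \<open>d\<close> need not be attained in \<open>S\<close>. An excess of \<open>r\<^sup>2\<close> in the squared distance is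
      of the size of the curvature error, so the gap \<open>h\<close> absorbs both.\<close>
    have "d < sqrt (d\<^sup>2 + r\<^sup>2)" using d \<rho> r by (intro real_less_rsqrt) simp
    then obtain y where y: "y \<in> S" and zy: "dist z y < min \<rho> (sqrt (d\<^sup>2 + r\<^sup>2))"
      using near[of z "min \<rho> (sqrt (d\<^sup>2 + r\<^sup>2))"] d unfolding d_def by auto
    have da: "d \<le> dist z y" unfolding d_def using y by (rule infdist_le)
    have "(dist z y)\<^sup>2 < (sqrt (d\<^sup>2 + r\<^sup>2))\<^sup>2" using zy by (intro power_strict_mono) auto
    then have a2: "(dist z y)\<^sup>2 < d\<^sup>2 + r\<^sup>2" by simp
    have "h * (\<rho> / 2) \<le> h * dist z y" using d da h by (intro mult_left_mono) auto
    then have rh: "r \<le> dist z y * h" "r' \<le> dist z y * h" using r r' by (auto simp: mult.commute)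
    define V where "V = measure lborel (cball y r)"
    have V: "0 < V" using r by (simp add: V_def)
    have "q / 2 * V \<le> measure lborel (cball y r \<inter> ball z d)"
    proof -
      have "r * r \<le> r * (dist z y * h)" using r rh by (intro mult_left_mono) auto
      then have "r\<^sup>2 + (dist y z)\<^sup>2 < d\<^sup>2 + 2 * r * dist y z * h"
        using a2 by (simp add: dist_commute power2_eq_square mult.assoc)
      then show ?thesis unfolding q_def V_def
        using r h d \<rho> by (intro measure_cball_Int_ball_ge) auto
    qed
    moreover have "measure lborel (cball y r \<inter> S) + measure lborel (cball y r \<inter> ball z d) \<le> V"
    proof -
      have disj: "(cball y r \<inter> S) \<inter> (cball y r \<inter> ball z d) = {}"
        using infdist_le[of _ S z] by (fastforce simp: d_def)
      have "measure lborel ((cball y r \<inter> S) \<union> (cball y r \<inter> ball z d))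
          = measure lborel (cball y r \<inter> S) + measure lborel (cball y r \<inter> ball z d)"
        using disj emeasure_bounded_finite[of "cball y r \<inter> S"]
          emeasure_bounded_finite[of "cball y r \<inter> ball z d"]
        by (intro measure_Union) (auto simp: bounded_Int)
      moreover have "measure lborel ((cball y r \<inter> S) \<union> (cball y r \<inter> ball z d)) \<le> V"
        unfolding V_def by (intro measure_mono_fmeasurable) (auto intro!: fmeasurable_compact)
      ultimately show ?thesis by simp
    qed
    ultimately have "measure lborel (cball y r \<inter> S) \<le> (1 - q / 2) * V" by (simp add: algebra_simps)
    then have "(f y + \<eta>) * measure lborel (cball y r \<inter> S) \<le> (f y + \<eta>) * ((1 - q / 2) * V)"
      using f_nonneg[of y] \<eta> by (intro mult_left_mono) auto
    with upper[OF y] have "t * V \<le> ((f y + \<eta>) * (1 - q / 2)) * V" by (simp add: V_def mult.assoc)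
    then have t_le: "t \<le> (f y + \<eta>) * (1 - q / 2)" using V by simp
    \<comment> \<open>So \<open>f y\<close> is about \<open>2 * t\<close> when \<open>q\<close> is close to \<open>1\<close>. The complementary fraction \<open>1 - q / 2\<close> is
      now traded for the fraction \<open>q / 2\<close> that is available around \<open>z\<close>.\<close>
    have "(f y + \<eta>) * (1 - q) \<le> (M + \<eta>) * (1 - q)"
      using M q by (intro mult_right_mono) auto
    moreover have "\<eta> * q \<le> \<eta> * 1" using \<eta> q by (intro mult_left_mono) auto
    moreover have "(f y - \<eta>) * (q / 2) = (f y + \<eta>) * (1 - q / 2) - (f y + \<eta>) * (1 - q) - \<eta> * q"
      by (simp add: field_simps)
    ultimately have key: "t - \<epsilon> \<le> (f y - \<eta>) * (q / 2)"
      using t_le \<epsilon>' \<eta> \<open>0 \<le> (M + \<eta>) * (1 - q)\<close> by linarith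
    then have "0 \<le> (f y - \<eta>) * (q / 2)" using t by linarith
    then have fy: "0 \<le> f y - \<eta>" using q by (simp add: zero_le_mult_iff)
    have sub: "cball z r' \<inter> ball y \<rho> \<subseteq> cball z r' \<inter> S'"
    proof
      fix p assume "p \<in> cball z r' \<inter> ball y \<rho>"
      then show "p \<in> cball z r' \<inter> S'"
        using infdist_le[OF y, of p] by (simp add: S'_def dist_commute)
    qed
    have "(t - \<epsilon>) * measure lborel (cball z r') \<le> (f y - \<eta>) * (q / 2) * measure lborel (cball z r')"
      using key by (intro mult_right_mono) auto
    also have "\<dots> = (f y - \<eta>) * (q / 2 * measure lborel (cball z r'))" by simp
    also have "\<dots> \<le> (f y - \<eta>) * measure lborel (cball z r' \<inter> ball y \<rho>)"
    proof (rule mult_left_mono[OF _ fy])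
      have "r' * r' \<le> r' * (dist z y * h)" using r' rh by (intro mult_left_mono) auto
      moreover have "0 \<le> r' * (dist z y * h)" using r' h by simp
      moreover have "(dist z y)\<^sup>2 < \<rho>\<^sup>2" using zy by (intro power_strict_mono) auto
      ultimately have "r'\<^sup>2 + (dist z y)\<^sup>2 < \<rho>\<^sup>2 + 2 * r' * dist z y * h"
        by (simp add: power2_eq_square mult.assoc)
      then show "q / 2 * measure lborel (cball z r') \<le> measure lborel (cball z r' \<inter> ball y \<rho>)"
        unfolding q_def using r' h \<rho> by (intro measure_cball_Int_ball_ge) auto
    qed
    also have "\<dots> \<le> (LINT p:cball z r' \<inter> ball y \<rho>|lborel. f p)"
    proof (rule set_integral_f_bounds)
      fix p assume "p \<in> cball z r' \<inter> ball y \<rho>"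
      then have "\<bar>f p - f y\<bar> \<le> \<eta>" by (intro osc) (simp add: dist_commute)
      then show "f y - \<eta> \<le> f p" by linarith
    qed (auto intro: bounded_Int)
    also have "\<dots> \<le> (LINT p:cball z r' \<inter> S'|lborel. f p)"
      by (intro set_integral_f_mono sub) auto
    finally show ?thesis .
  qed
  then show ?thesis unfolding self_supporting_def S'_def[symmetric] by simp
qed

text \<open>
  Around a point, \<open>f\<close> stays within \<open>1\<close> of its value on a ball of fixed volume, where its integral
  is at most its total integral.
\<close>

lemma uniformly_continuous_density_bounded:
  assumes uc: "uniformly_continuous_on UNIV f"
  obtains M where "\<And>x. f x \<le> M"
proof -
  obtain \<delta> where \<delta>: "0 < \<delta>" "\<And>x y. dist y x < \<delta> \<Longrightarrow> dist (f y) (f x) < 1"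
    using uc unfolding uniformly_continuous_on_def by (metis UNIV_I zero_less_one)
  have "f x \<le> (LINT z|lborel. f z) / measure lborel (ball (0::'a) \<delta>) + 1" for x
  proof -
    have V: "measure lborel (ball x \<delta>) = measure lborel (ball (0::'a) \<delta>)"
      using \<delta>(1) by (simp add: content_ball)
    have "(f x - 1) * measure lborel (ball x \<delta>) \<le> (LINT z:ball x \<delta>|lborel. f z)"
    proof (rule set_integral_f_bounds)
      fix z assume "z \<in> ball x \<delta>"
      then show "f x - 1 \<le> f z" using \<delta>(2)[of z x] by (auto simp: dist_commute dist_real_def)
    qed auto
    also have "\<dots> \<le> (LINT z:UNIV|lborel. f z)" by (intro set_integral_f_mono) auto
    finally show ?thesis using \<delta>(1) by (simp add: V set_lebesgue_integral_def field_simps)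
  qed
  then show ?thesis using that by blast
qed

lemma coreness_scale_comparison:
  assumes uc: "uniformly_continuous_on UNIV f" and \<epsilon>: "0 < \<epsilon>"
  obtains r0 where "0 < r0" and "\<And>r r' x. 0 < r \<Longrightarrow> r < r0 \<Longrightarrow> 0 < r' \<Longrightarrow> r' < r0 \<Longrightarrow>
    continuum_coreness f r x - \<epsilon> \<le> continuum_coreness f r' x"
proof -
  obtain M where M: "\<And>x. f x \<le> M" using uniformly_continuous_density_bounded[OF uc] by blast
  define \<eta> where "\<eta> = \<epsilon> / 8"
  have \<eta>: "0 < \<eta>" using \<epsilon> by (simp add: \<eta>_def)
  have "((\<lambda>h. 4 * \<eta> + 2 * (M + \<eta>) * (1 - (1 - h) ^ DIM('a))) \<longlongrightarrow> 4 * \<eta>) (at_right 0)"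
    by (auto intro!: tendsto_eq_intros)
  moreover have "4 * \<eta> < \<epsilon>" using \<epsilon> by (simp add: \<eta>_def)
  ultimately have "eventually (\<lambda>h. 4 * \<eta> + 2 * (M + \<eta>) * (1 - (1 - h) ^ DIM('a)) < \<epsilon>) (at_right 0)"
    by (rule order_tendstoD(2))
  moreover have "eventually (\<lambda>h. h \<in> {0<..<1/2::real}) (at_right 0)"
    by (rule eventually_at_right_real) simp
  ultimately have "eventually (\<lambda>h. 4 * \<eta> + 2 * (M + \<eta>) * (1 - (1 - h) ^ DIM('a)) < \<epsilon> \<and>
      h \<in> {0<..<1/2::real}) (at_right 0)" by (rule eventually_conj)
  then obtain h where h: "4 * \<eta> + 2 * (M + \<eta>) * (1 - (1 - h) ^ DIM('a)) \<le> \<epsilon>" "0 < h" "h \<le> 1/2"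
    by (auto dest!: eventually_happens intro: that less_imp_le)
  obtain \<rho> where \<rho>: "0 < \<rho>" "\<And>x y. dist y x < \<rho> \<Longrightarrow> dist (f y) (f x) < \<eta>"
    using uc \<eta> unfolding uniformly_continuous_on_def by (metis UNIV_I)
  have osc: "\<bar>f x - f y\<bar> \<le> \<eta>" if "dist x y < \<rho>" for x y
    using \<rho>(2)[OF that] by (simp add: dist_real_def)
  show ?thesis
  proof (rule that[of "h * \<rho> / 2"])
    show "0 < h * \<rho> / 2" using h \<rho> by simp
    fix r r' x assume r: "0 < r" "r < h * \<rho> / 2" and r': "0 < r'" "r' < h * \<rho> / 2"
    define t where "t = continuum_coreness f r x"
    define S where "S = {y. t \<le> continuum_coreness f r y}"
    have x: "x \<in> S" by (simp add: S_def t_def)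
    show "t - \<epsilon> \<le> continuum_coreness f r' x"
    proof (cases "\<epsilon> \<le> t")
      case True
      \<comment> \<open>Thicken the superlevel set of \<open>x\<close> at scale \<open>r\<close> and read off the coreness at scale \<open>r'\<close>.\<close>
      have "self_supporting r t S"
        unfolding S_def using r True \<epsilon> by (intro self_supporting_coreness_superlevel) auto
      then have "self_supporting r' (t - \<epsilon>) {z. infdist z S < \<rho>}"
        using h \<rho>(1) r r' x True
        by (intro self_supporting_thickening[where h = h and \<eta> = \<eta> and M = M and r = r] osc M) auto
      then show ?thesis
        using True r' x \<rho>(1)
        by (intro le_coreness_if_self_supporting[where S = "{z. infdist z S < \<rho>}"]) auto
    next
      case False
      then show ?thesis using coreness_nonneg[OF r'(1), of x] by linarith
    qed
  qed
qed

end

section \<open>Uniform convergence\<close>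

text \<open>
  The pointwise limit along \<open>1 / (n + 1)\<close> serves as the uniform limit along the whole filter.
\<close>

lemma uniform_limit_at_right_0_if_Cauchy:
  fixes g :: "real \<Rightarrow> 'b \<Rightarrow> real"
  assumes "\<And>\<epsilon>. 0 < \<epsilon> \<Longrightarrow>
    \<exists>r0>0. \<forall>r r' x. 0 < r \<longrightarrow> r < r0 \<longrightarrow> 0 < r' \<longrightarrow> r' < r0 \<longrightarrow> \<bar>g r x - g r' x\<bar> \<le> \<epsilon>"
  shows "\<exists>l. uniform_limit UNIV g l (at_right 0)"
proof -
  define s where "s n = inverse (real (Suc n))" for n
  have s: "s \<longlonglongrightarrow> 0" "\<And>n. 0 < s n"
    using LIMSEQ_inverse_real_of_nat by (auto simp: s_def[abs_def])
  have ev: "\<exists>N. \<forall>n\<ge>N. s n < r0" if "0 < r0" for r0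
    using order_tendstoD(2)[OF s(1) that] by (simp add: eventually_sequentially)
  have "Cauchy (\<lambda>n. g (s n) x)" for x
  proof (rule CauchyI)
    fix e :: real assume "0 < e"
    then obtain r0 where r0: "r0 > 0" "\<And>r r' x. 0 < r \<Longrightarrow> r < r0 \<Longrightarrow> 0 < r' \<Longrightarrow> r' < r0 \<Longrightarrow> \<bar>g r x - g r' x\<bar> \<le> e / 2"
      using assms[of "e / 2"] by auto
    obtain N where N: "\<And>n. n \<ge> N \<Longrightarrow> s n < r0" using ev[OF r0(1)] by blast
    have "norm (g (s m) x - g (s n) x) < e" if "m \<ge> N" "n \<ge> N" for m n
      using r0(2)[of "s m" "s n" x] s(2) N that \<open>0 < e\<close> by auto
    then show "\<exists>N. \<forall>m\<ge>N. \<forall>n\<ge>N. norm (g (s m) x - g (s n) x) < e" by blast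
  qed
  then have lim: "(\<lambda>n. g (s n) x) \<longlonglongrightarrow> lim (\<lambda>n. g (s n) x)" for x
    by (simp add: Cauchy_convergent_iff convergent_LIMSEQ_iff)
  have "uniform_limit UNIV g (\<lambda>x. lim (\<lambda>n. g (s n) x)) (at_right 0)"
  proof (rule uniform_limitI)
    fix e :: real assume "0 < e"
    then obtain r0 where r0: "r0 > 0" "\<And>r r' x. 0 < r \<Longrightarrow> r < r0 \<Longrightarrow> 0 < r' \<Longrightarrow> r' < r0 \<Longrightarrow> \<bar>g r x - g r' x\<bar> \<le> e / 2"
      using assms[of "e / 2"] by auto
    obtain N where N: "\<And>n. n \<ge> N \<Longrightarrow> s n < r0" using ev[OF r0(1)] by blast
    have "dist (g r x) (lim (\<lambda>n. g (s n) x)) < e" if r: "0 < r" "r < r0" for r x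
    proof -
      have "(\<lambda>n. \<bar>g r x - g (s n) x\<bar>) \<longlonglongrightarrow> \<bar>g r x - lim (\<lambda>n. g (s n) x)\<bar>"
        by (intro tendsto_intros lim)
      then have "\<bar>g r x - lim (\<lambda>n. g (s n) x)\<bar> \<le> e / 2"
        using r0(2)[of r "s _" x] s(2) N r by (intro LIMSEQ_le_const2) blast+
      then show ?thesis using \<open>0 < e\<close> by (simp add: dist_real_def)
    qed
    then show "\<forall>\<^sub>F r in at_right 0. \<forall>x\<in>UNIV. dist (g r x) (lim (\<lambda>n. g (s n) x)) < e"
      using r0(1) by (auto simp: eventually_at_right_field)
  qed
  then show ?thesis by blast
qed

theorem proposition3p6:
  fixes f :: "'a::euclidean_space \<Rightarrow> real"
  assumes "prob_density f"
    and "uniformly_continuous_on UNIV f"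
  shows "\<exists>C0 :: 'a \<Rightarrow> real. uniform_limit UNIV (\<lambda>r x. continuum_coreness f r x) C0 (at_right 0)"
proof (rule uniform_limit_at_right_0_if_Cauchy)
  have f: "0 \<le> f x" "integrable lborel f" for x
    using assms(1) by (auto simp: prob_density_def intro: integrable.intros)
  fix \<epsilon> :: real assume "0 < \<epsilon>"
  then obtain r0 where r0: "0 < r0" "\<And>r r' x. 0 < r \<Longrightarrow> r < r0 \<Longrightarrow> 0 < r' \<Longrightarrow> r' < r0 \<Longrightarrow>
    continuum_coreness f r x - \<epsilon> \<le> continuum_coreness f r' x"
    using coreness_scale_comparison[OF f assms(2)] by blast
  have "\<bar>continuum_coreness f r x - continuum_coreness f r' x\<bar> \<le> \<epsilon>"
    if "0 < r" "r < r0" "0 < r'" "r' < r0" for r r' x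
    using r0(2)[of r r' x] r0(2)[of r' r x] that by linarith
  with r0(1) show "\<exists>r0>0. \<forall>r r' x. 0 < r \<longrightarrow> r < r0 \<longrightarrow> 0 < r' \<longrightarrow> r' < r0 \<longrightarrow>
      \<bar>continuum_coreness f r x - continuum_coreness f r' x\<bar> \<le> \<epsilon>" by blast
qed

end
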